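(* Let $k$ be a positive integer and let $\mathcal{C}$ be a self-dual $\mathbb{Z}_4$-code of length $24k+8$. Suppose that the minimum Lee weight of $\mathcal{C}$ is $8k+8$ or $8k+6$. Then the residue code $\mathcal{C}^{(1)}$ is a binary extremal doubly even self-dual code of length $24k+8$.
   Context: A $\mathbb{Z}_4$-code of length $n$ is a $\mathbb{Z}_4$-submodule $\mathcal{C}$ of $\mathbb{Z}_4^n$, where $\mathbb{Z}_4=\{0,1,2,3\}$ is the ring of integers modulo $4$. Its dual is $\mathcal{C}^\perp=\{x\in\mathbb{Z}_4^n \mid x\cdot y=0 \text{ for all } y\in\mathcal{C}\}$, with $x\cdot y$ the standard inner product; $\mathcal{C}$ is self-dual if $\mathcal{C}=\mathcal{C}^\perp$. For $x\in\mathbb{Z}_4^n$ let $n_i(x)$ be the number of components of $x$ equal to $i$. The Lee weight of $x$ is $n_1(x)+2n_2(x)+n_3(x)$, and the minimum Lee weight of $\mathcal{C}$ is the smallest Lee weight among all non-zero codewords of $\mathcal{C}$. The residue code of $\mathcal{C}$ is the binary code $\mathcal{C}^{(1)}=\{c \bmod 2 \mid c\in\mathcal{C}\}$. A binary code is a linear subspace of $\mathbb{Z}_2^n$; it is self-dual if it equals its dual under the standard inner product, and doubly even if all its codewords have Hamming weight divisible by $4$. A binary self-dual code of length $n$ is extremal if its minimum weight equals $4\lfloor n/24\rfloor+6$ when $n\equiv 22 \pmod{24}$, and $4\lfloor n/24\rfloor+4$ otherwise. Thus an extremal code of length $24k+8$ has minimum weight $4k+4$. *)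

theory Defs
  imports "HOL-Analysis.Analysis" "HOL-Library.Numeral_Type" "HOL-Library.Z2"
begin

text \<open>
  The numeral type \<open>4\<close> carries the ring structure of the integers modulo 4, and \<open>bit\<close> is the
  field with two elements. A word of length \<open>n\<close> over a ring is a vector of type \<open>'a ^ 'n\<close> with
  \<open>CARD('n) = n\<close>.
\<close>

type_synonym z4 = 4

lemma module_vector_scalar_mult: "module ((*s) :: 'a::comm_ring_1 \<Rightarrow> 'a ^ 'n \<Rightarrow> 'a ^ 'n)"
  by unfold_locales (simp_all add: vec_eq_iff algebra_simps)

definition linear_code :: "('a::comm_ring_1 ^ 'n) set \<Rightarrow> bool" where
  "linear_code C \<longleftrightarrow> module.subspace (*s) C"

definition std_inner :: "'a::comm_ring_1 ^ 'n \<Rightarrow> 'a ^ 'n \<Rightarrow> 'a" where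
  "std_inner x y = (\<Sum>i\<in>UNIV. x $ i * y $ i)"

definition dual_code :: "('a::comm_ring_1 ^ 'n) set \<Rightarrow> ('a ^ 'n) set" where
  "dual_code C = {x. \<forall>y\<in>C. std_inner x y = 0}"

definition self_dual_code :: "('a::comm_ring_1 ^ 'n) set \<Rightarrow> bool" where
  "self_dual_code C \<longleftrightarrow> linear_code C \<and> C = dual_code C"

definition num_comps :: "'a \<Rightarrow> 'a ^ 'n \<Rightarrow> nat" where
  "num_comps a x = card {i. x $ i = a}"

definition lee_weight :: "z4 ^ 'n \<Rightarrow> nat" where
  "lee_weight x = num_comps 1 x + 2 * num_comps 2 x + num_comps 3 x"

text \<open>
  The two minimum weights below are unspecified for the zero code, which is never self-dual in
  positive length.
\<close>

definition min_lee_weight :: "(z4 ^ 'n) set \<Rightarrow> nat" where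
  "min_lee_weight C = Min (lee_weight ` (C - {0}))"

definition z4_mod2 :: "z4 \<Rightarrow> bit" where
  "z4_mod2 a = (if a = 1 \<or> a = 3 then 1 else 0)"

lemma z4_mod2_of_nat: "z4_mod2 (of_nat m) = of_nat m"
proof -
  have four: "(4 :: z4) = 0"
    by simp
  have "(of_nat m :: z4) = of_nat (m mod 4 + 4 * (m div 4))"
    by simp
  also have "\<dots> = of_nat (m mod 4)"
    by (simp only: of_nat_add of_nat_mult of_nat_numeral four mult_zero_left add_0_right)
  finally have 1: "(of_nat m :: z4) = of_nat (m mod 4)" .
  have "(of_nat m :: bit) = of_nat (m mod 4 + 2 * (2 * (m div 4)))"
    by simp
  also have "\<dots> = of_nat (m mod 4)"
    unfolding of_nat_add of_nat_mult by simp
  finally have 2: "(of_nat m :: bit) = of_nat (m mod 4)" .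
  have "m mod 4 < 4" by simp
  then have "m mod 4 = 0 \<or> m mod 4 = 1 \<or> m mod 4 = 2 \<or> m mod 4 = 3" by arith
  then show ?thesis
    unfolding 1 2 by (auto simp: z4_mod2_def)
qed

definition residue_code :: "(z4 ^ 'n) set \<Rightarrow> (bit ^ 'n) set" where
  "residue_code C = (\<lambda>c. \<chi> i. z4_mod2 (c $ i)) ` C"

definition hamming_weight :: "bit ^ 'n \<Rightarrow> nat" where
  "hamming_weight x = card {i. x $ i \<noteq> 0}"

definition min_weight :: "(bit ^ 'n) set \<Rightarrow> nat" where
  "min_weight C = Min (hamming_weight ` (C - {0}))"

definition doubly_even :: "(bit ^ 'n) set \<Rightarrow> bool" where
  "doubly_even C \<longleftrightarrow> (\<forall>x\<in>C. 4 dvd hamming_weight x)"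

definition extremal_self_dual :: "(bit ^ 'n) set \<Rightarrow> bool" where
  "extremal_self_dual C \<longleftrightarrow> self_dual_code C \<and>
     min_weight C = (if CARD('n) mod 24 = 22 then 4 * (CARD('n) div 24) + 6
                     else 4 * (CARD('n) div 24) + 4)"

end

(*
  Let T be the dual of the residue code R. Doubling a word of T gives a codeword of C, so T has
  minimum weight at least 4k + 3, while R is doubly even. A maximal doubly even code D containing R
  is self-dual: otherwise all words of the dual of D outside D have weight 2 mod 4, and the
  MacWilliams identity at y = i makes |D| - |D^perp - D| positive. Then R <= D <= T.

  On power series in y, the operator L f = (1 - y^2) f' + n y f has the eigenvectors
  (1 - y)^w (1 + y)^(n - w) with eigenvalues n - 2w, and it lowers the order of vanishing at 0 by at
  most one. The nonzero weights of D take at most 4k + 2 values, so applying the corresponding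
  operators L - (n - 2w) to the transformed weight enumerator of a coset of D shows that every coset
  contains a word of weight at most 4k + 2 (Delsarte's bound). Hence T = D, and R = D by counting.

  If D had no nonzero word of weight at most 4k + 4, then
    sum_u w(n - w) (1 - y)^w (1 + y)^(n - w) = c (1 - y^2) + O(y^(4k + 1)),  w = wt(u),  c > 0,
  because n^2 - L^2 multiplies each summand by 4w(n - w), which removes the weights 0 and n.
  In terms of rho = ((1 + y) / (1 - y))^4 the left-hand side is, up to a common factor, a polynomial
  in rho of degree at most 4k - 2, so its product with (rho + 1) (rho - 1)^(-4k - 1) rho' has residue
  zero. On the right-hand side the residue is a positive multiple of the coefficient of y^(4k) in
  (1 + 6y^2 + y^4) (1 + y^2)^3 (1 - y^4)^(-4k - 4), which is positive.
*)
theory Submission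
  imports Defs "HOL-Computational_Algebra.Formal_Laurent_Series"
begin

section \<open>The MacWilliams identity for cosets\<close>

lemma UNIV_bit: "(UNIV :: bit set) = {0, 1}"
  by (auto simp: bit_not_one_iff)

instance bit :: finite
  by standard (simp add: UNIV_bit)

declare add_bit_eq_xor [simp del] mult_bit_eq_and [simp del]

text \<open>The nontrivial character of the additive group of two elements. Its values lie in an
  arbitrary commutative ring, so that one identity serves integers, complex numbers and power
  series.\<close>

definition chi :: "bit \<Rightarrow> 'a::comm_ring_1" where
  "chi b = (if b = 0 then 1 else -1)"

lemma chi_add: "chi (a + b) = chi a * chi b"
  by (cases a; cases b) (simp_all add: chi_def)

lemma chi_0 [simp]: "chi 0 = 1" by (simp add: chi_def)

lemma chi_sum: "chi (sum f A) = (\<Prod>i\<in>A. chi (f i))"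
  by (induction A rule: infinite_finite_induct)
    (simp_all add: chi_add)

lemma std_inner_add_left: "std_inner (x + y) z = std_inner x z + std_inner y z"
  by (simp add: std_inner_def distrib_right sum.distrib)

lemma std_inner_add_right: "std_inner z (x + y) = std_inner z x + std_inner z y"
  by (simp add: std_inner_def distrib_left sum.distrib)

lemma std_inner_scale_left: "std_inner (c *s x) z = c * std_inner x z"
  by (simp add: std_inner_def sum_distrib_left mult.assoc)

lemma std_inner_commute: "std_inner x y = std_inner y x"
  by (simp add: std_inner_def mult.commute)

lemma linear_code_iff:
  "linear_code C \<longleftrightarrow> 0 \<in> C \<and> (\<forall>x\<in>C. \<forall>y\<in>C. x + y \<in> C) \<and> (\<forall>c. \<forall>x\<in>C. c *s x \<in> C)"
  by (simp add: linear_code_def module.subspace_def[OF module_vector_scalar_mult])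

lemma binary_linear_code_iff:
  fixes C :: "(bit ^ 'n) set"
  shows "linear_code C \<longleftrightarrow> 0 \<in> C \<and> (\<forall>x\<in>C. \<forall>y\<in>C. x + y \<in> C)"
proof -
  have "c *s x \<in> C" if "0 \<in> C" "x \<in> C" for c and x :: "bit ^ 'n"
    using that by (cases c) simp_all
  then show ?thesis unfolding linear_code_iff by blast
qed

lemma linear_dual_code: "linear_code (dual_code C)"
  unfolding linear_code_iff dual_code_def
  by (simp add: std_inner_add_left std_inner_scale_left) (simp add: std_inner_def)

lemma bit_vec_add_self [simp]: "x + x = (0 :: bit ^ 'n)"
  by (simp add: vec_eq_iff)

lemma hamming_weight_eq_0_iff [simp]: "hamming_weight x = 0 \<longleftrightarrow> x = 0"
  by (auto simp: hamming_weight_def vec_eq_iff)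

lemma hamming_weight_0 [simp]: "hamming_weight 0 = 0"
  by simp

lemma hamming_weight_le: "hamming_weight (x :: bit ^ 'n) \<le> CARD('n)"
  by (simp add: hamming_weight_def card_mono)

lemma prod_bit_vec:
  fixes x :: "bit ^ 'n"
  shows "(\<Prod>i\<in>UNIV. if x $ i = 0 then a else b) =
    (b :: 'a::comm_monoid_mult) ^ hamming_weight x * a ^ (CARD('n) - hamming_weight x)"
proof -
  have "(\<Prod>i\<in>UNIV. if x $ i = 0 then a else b) =
      (\<Prod>i\<in>{i. x $ i = 0}. a) * (\<Prod>i\<in>{i. x $ i \<noteq> 0}. b)"
    by (subst prod.If_cases) (auto simp: Compl_eq)
  moreover have "card {i. x $ i = 0} = CARD('n) - hamming_weight x"
  proof -
    have "{i. x $ i = 0} = UNIV - {i. x $ i \<noteq> 0}" by auto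
    then show ?thesis by (simp add: hamming_weight_def card_Diff_subset)
  qed
  ultimately show ?thesis by (simp add: hamming_weight_def mult.commute)
qed

lemma sum_prod_bit_vec:
  fixes f :: "'n::finite \<Rightarrow> bit \<Rightarrow> 'a::comm_semiring_1"
  shows "(\<Sum>x\<in>(UNIV :: (bit ^ 'n) set). \<Prod>i\<in>UNIV. f i (x $ i)) = (\<Prod>i\<in>UNIV. f i 0 + f i 1)"
proof -
  have "(\<Prod>i\<in>UNIV. f i 0 + f i 1) = (\<Prod>i\<in>UNIV. \<Sum>b\<in>(UNIV :: bit set). f i b)"
    by (simp add: UNIV_bit)
  also have "\<dots> = (\<Sum>g\<in>UNIV \<rightarrow>\<^sub>E UNIV. \<Prod>i\<in>UNIV. f i (g i))"
    by (rule prod_sum_PiE) auto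
  also have "\<dots> = (\<Sum>x\<in>(UNIV :: (bit ^ 'n) set). \<Prod>i\<in>UNIV. f i (x $ i))"
    by (rule sum.reindex_bij_witness[of _ vec_nth vec_lambda]) auto
  finally show ?thesis by simp
qed

text \<open>Orthogonality of characters: if some \<open>u0\<close> in \<open>D\<close> is not
  orthogonal to \<open>x\<close>, translation by \<open>u0\<close> negates the sum, which therefore
  vanishes in characteristic 0.\<close>

lemma sum_chi_std_inner:
  fixes D :: "(bit ^ 'n) set"
  assumes "linear_code D"
  shows "(\<Sum>u\<in>D. chi (std_inner u x)) =
    (if x \<in> dual_code D then of_nat (card D) else (0 :: 'a::{idom,semiring_char_0}))"
proof (cases "x \<in> dual_code D")
  case True
  then show ?thesis by (simp add: dual_code_def std_inner_commute)
next
  case False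
  then obtain u0 where u0: "u0 \<in> D" "std_inner u0 x = 1"
    by (auto simp: dual_code_def std_inner_commute)
  have "(\<Sum>u\<in>D. chi (std_inner u x)) = (\<Sum>u\<in>D. chi (std_inner (u + u0) x) :: 'a)"
    using assms u0(1)
    by (intro sum.reindex_bij_witness[of _ "\<lambda>u. u + u0" "\<lambda>u. u + u0"])
      (auto simp: binary_linear_code_iff add.assoc)
  also have "\<dots> = - (\<Sum>u\<in>D. chi (std_inner u x))"
    by (simp only: std_inner_add_left chi_add u0(2) sum_negf[symmetric]) (simp add: chi_def)
  finally have "2 * (\<Sum>u\<in>D. chi (std_inner u x) :: 'a) = 0"
    by (simp add: eq_neg_iff_add_eq_0)
  with False show ?thesis by simp
qed

text \<open>Character and weight monomial are both products over the coordinates, so the transform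
  factors: a coordinate with \<open>u $ i = 0\<close> gives \<open>1 + y\<close>, any other gives
  \<open>1 - y\<close>.\<close>

lemma sum_chi_power_weight:
  fixes u :: "bit ^ 'n" and y :: "'a::comm_ring_1"
  shows "(\<Sum>x\<in>UNIV. chi (std_inner u x) * y ^ hamming_weight x) =
    (1 - y) ^ hamming_weight u * (1 + y) ^ (CARD('n) - hamming_weight u)"
proof -
  have y: "y ^ hamming_weight x = (\<Prod>i\<in>UNIV. if x $ i = 0 then 1 else y)" for x :: "bit ^ 'n"
    by (simp add: prod_bit_vec)
  have "(\<Sum>x\<in>UNIV. chi (std_inner u x) * y ^ hamming_weight x) =
      (\<Sum>x\<in>UNIV. \<Prod>i\<in>UNIV. chi (u $ i * x $ i) * (if x $ i = 0 then 1 else y))"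
    by (simp only: y std_inner_def chi_sum prod.distrib)
  also have "\<dots> = (\<Prod>i\<in>UNIV. if u $ i = 0 then 1 + y else 1 - y)"
    by (subst sum_prod_bit_vec) (rule prod.cong, auto simp: chi_def)
  finally show ?thesis by (simp add: prod_bit_vec)
qed

text \<open>Poisson summation: the indicator of the dual is expanded into characters and the sums
  are exchanged. The shift by \<open>v\<close> only inserts the sign
  \<open>chi (std_inner u v)\<close>.\<close>

theorem macwilliams_coset:
  fixes D :: "(bit ^ 'n) set" and y :: "'a::{idom,semiring_char_0}"
  assumes "linear_code D"
  shows "of_nat (card D) * (\<Sum>x\<in>dual_code D. y ^ hamming_weight (x + v)) =
    (\<Sum>u\<in>D. chi (std_inner u v) *
      ((1 - y) ^ hamming_weight u * (1 + y) ^ (CARD('n) - hamming_weight u)))"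
proof -
  have "of_nat (card D) * (\<Sum>x\<in>dual_code D. y ^ hamming_weight (x + v)) =
      (\<Sum>x\<in>UNIV. (\<Sum>u\<in>D. chi (std_inner u x)) * y ^ hamming_weight (x + v))"
    unfolding sum_chi_std_inner[OF assms] sum_distrib_left
    by (rule sum.mono_neutral_cong_left) auto
  also have "\<dots> = (\<Sum>u\<in>D. \<Sum>x\<in>UNIV. chi (std_inner u x) * y ^ hamming_weight (x + v))"
    unfolding sum_distrib_right by (rule sum.swap)
  also have "\<dots> = (\<Sum>u\<in>D. \<Sum>x\<in>UNIV. chi (std_inner u (x + v)) * y ^ hamming_weight x)"
    by (intro sum.cong[OF refl] sum.reindex_bij_witness[of _ "\<lambda>x. x + v" "\<lambda>x. x + v"])
      (auto simp: add.assoc)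
  also have "\<dots> = (\<Sum>u\<in>D. chi (std_inner u v) *
      (\<Sum>x\<in>UNIV. chi (std_inner u x) * y ^ hamming_weight x))"
    by (simp add: std_inner_add_right chi_add sum_distrib_left mult_ac)
  finally show ?thesis by (simp only: sum_chi_power_weight)
qed

corollary macwilliams:
  fixes D :: "(bit ^ 'n) set" and y :: "'a::{idom,semiring_char_0}"
  assumes "linear_code D"
  shows "of_nat (card D) * (\<Sum>x\<in>dual_code D. y ^ hamming_weight x) =
    (\<Sum>u\<in>D. (1 - y) ^ hamming_weight u * (1 + y) ^ (CARD('n) - hamming_weight u))"
  using macwilliams_coset[OF assms, of y 0] by (simp add: std_inner_def)

lemma card_mult_card_dual_code:
  fixes D :: "(bit ^ 'n) set"
  assumes "linear_code D"
  shows "card D * card (dual_code D) = 2 ^ CARD('n)"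
proof -
  have "0 \<in> D" using assms by (simp add: linear_code_iff)
  then have "(\<Sum>u\<in>D. if u = 0 then 2 ^ (CARD('n) - hamming_weight u) else 0) = (2::int) ^ CARD('n)"
    by (subst sum.delta) auto
  \<comment> \<open>At \<open>y = 1\<close> the factor \<open>(1 - y) ^ hamming_weight u\<close>
    kills every summand except \<open>u = 0\<close>.\<close>
  then have "int (card D) * int (card (dual_code D)) = 2 ^ CARD('n)"
    using macwilliams[OF assms, of "1::int"]
    by (simp add: power_0_left if_distrib[of "\<lambda>a. a * _"] cong: if_cong)
  then show ?thesis
    by (metis (mono_tags) of_nat_eq_iff of_nat_mult of_nat_numeral of_nat_power)
qed

section \<open>Doubly even codes\<close>

lemma ex_bit: "(\<exists>c::bit. P c) \<longleftrightarrow> P 0 \<or> P 1"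
  by (metis bit_not_one_iff)

lemma of_nat_bit: "(of_nat m :: bit) = (if even m then 0 else 1)"
  by (induction m) auto

lemma hamming_weight_add:
  "hamming_weight (x + y) + 2 * card {i. x $ i \<noteq> 0 \<and> y $ i \<noteq> 0} =
    hamming_weight x + hamming_weight (y :: bit ^ 'n)"
proof -
  let ?X = "{i. x $ i \<noteq> 0}" and ?Y = "{i. y $ i \<noteq> 0}"
  have "{i. (x + y) $ i \<noteq> 0} = (?X - ?Y) \<union> (?Y - ?X)"
    by (auto simp: bit_not_zero_iff)
  then have "hamming_weight (x + y) = card (?X - ?Y) + card (?Y - ?X)"
    unfolding hamming_weight_def by (simp only:) (rule card_Un_disjoint, auto)
  moreover have "card A = card (A - B) + card (A \<inter> B)" for A B :: "'n set"
  proof -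
    have "(A - B) \<inter> (A \<inter> B) = {}" by blast
    with card_Un_disjoint[of "A - B" "A \<inter> B"] show ?thesis by (simp add: Un_Diff_Int)
  qed
  from this[of ?X ?Y] this[of ?Y ?X]
  have "card ?X = card (?X - ?Y) + card (?X \<inter> ?Y)"
    "card ?Y = card (?Y - ?X) + card (?X \<inter> ?Y)"
    by (simp_all add: Int_commute)
  moreover have "{i. x $ i \<noteq> 0 \<and> y $ i \<noteq> 0} = ?X \<inter> ?Y" by auto
  ultimately show ?thesis by (simp add: hamming_weight_def)
qed

lemma std_inner_bit:
  "std_inner x y = (if even (card {i. x $ i \<noteq> 0 \<and> y $ i \<noteq> 0}) then 0 else (1::bit))"
proof -
  have "std_inner x y = (\<Sum>i\<in>{i. x $ i \<noteq> 0 \<and> y $ i \<noteq> 0}. 1)"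
    unfolding std_inner_def by (rule sum.mono_neutral_cong_right) auto
  then show ?thesis by (simp add: of_nat_bit)
qed

lemma std_inner_one_bit: "std_inner 1 x = (if even (hamming_weight x) then 0 else (1::bit))"
  by (simp add: std_inner_bit hamming_weight_def)

lemma hamming_weight_one: "hamming_weight (1 :: bit ^ 'n) = CARD('n)"
  by (simp add: hamming_weight_def)

lemma hamming_weight_add_one: "hamming_weight (x + 1) = CARD('n) - hamming_weight (x :: bit ^ 'n)"
  using hamming_weight_add[of x 1] by (simp add: hamming_weight_one) (simp add: hamming_weight_def)

text \<open>The weights of \<open>x\<close>, \<open>y\<close> and \<open>x + y\<close> are multiples
  of 4, hence so is twice the overlap of the supports, and the overlap is even.\<close>

lemma doubly_even_subset_dual_code:
  assumes "linear_code D" "doubly_even D"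
  shows "D \<subseteq> dual_code D"
proof (clarsimp simp: dual_code_def)
  fix x y assume xy: "x \<in> D" "y \<in> D"
  then have "x + y \<in> D" using assms(1) by (simp add: binary_linear_code_iff)
  with assms(2) xy have "4 dvd hamming_weight (x + y)" "4 dvd hamming_weight x + hamming_weight y"
    by (auto simp: doubly_even_def)
  then have "4 dvd 2 * card {i. x $ i \<noteq> 0 \<and> y $ i \<noteq> 0}"
    unfolding hamming_weight_add[of x y, symmetric] by (simp add: dvd_add_right_iff)
  then have "even (card {i. x $ i \<noteq> 0 \<and> y $ i \<noteq> 0})"
    by presburger
  then show "std_inner x y = 0" by (simp add: std_inner_bit)
qed

lemma one_in_dual_code:
  assumes "doubly_even D"
  shows "1 \<in> dual_code D"
proof -
  have "even (hamming_weight x)" if "x \<in> D" for x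
    using assms that dvd_trans[of 2 4 "hamming_weight x"] by (simp add: doubly_even_def)
  then show ?thesis by (simp add: dual_code_def std_inner_one_bit)
qed

text \<open>Orthogonality makes the overlap of \<open>x\<close> with each word of \<open>D\<close>
  even, so the correction term in \<open>hamming_weight_add\<close> is a multiple of 4.\<close>

lemma doubly_even_extend:
  assumes D: "linear_code D" "doubly_even D"
    and x: "x \<in> dual_code D" "4 dvd hamming_weight x"
  shows "linear_code (D \<union> (+) x ` D)" "doubly_even (D \<union> (+) x ` D)"
proof -
  have cl: "u + v \<in> D" if "u \<in> D" "v \<in> D" for u v
    using D(1) that by (simp add: binary_linear_code_iff)
  have E: "a \<in> D \<union> (+) x ` D \<longleftrightarrow> (\<exists>c. \<exists>u\<in>D. a = c *s x + u)" for a
    unfolding ex_bit by auto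
  have "a + b \<in> D \<union> (+) x ` D" if a: "a \<in> D \<union> (+) x ` D" and b: "b \<in> D \<union> (+) x ` D" for a b
  proof -
    obtain c u where cu: "u \<in> D" "a = c *s x + u" using a E by blast
    obtain d v where dv: "v \<in> D" "b = d *s x + v" using b E by blast
    have "a + b = (c + d) *s x + (u + v)"
      unfolding cu dv by (simp add: vec_eq_iff algebra_simps)
    with cl[OF cu(1) dv(1)] show ?thesis unfolding E by blast
  qed
  with D(1) show "linear_code (D \<union> (+) x ` D)"
    unfolding binary_linear_code_iff by blast
  have "4 dvd hamming_weight (x + u)" if u: "u \<in> D" for u
  proof -
    have "std_inner x u = 0" using x(1) u by (simp add: dual_code_def)
    then have "even (card {i. x $ i \<noteq> 0 \<and> u $ i \<noteq> 0})"
      by (simp add: std_inner_bit split: if_splits)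
    then have "4 dvd 2 * card {i. x $ i \<noteq> 0 \<and> u $ i \<noteq> 0}" by presburger
    moreover have "4 dvd hamming_weight x + hamming_weight u"
      using D(2) u x(2) by (simp add: doubly_even_def)
    ultimately show ?thesis
      unfolding hamming_weight_add[of x u, symmetric] by (simp add: dvd_add_left_iff)
  qed
  with D(2) show "doubly_even (D \<union> (+) x ` D)" by (auto simp: doubly_even_def)
qed

lemma i_power_eq_neg_one: "m mod 4 = 2 \<Longrightarrow> \<i> ^ m = -1"
proof -
  assume "m mod 4 = 2"
  then obtain j where "m = 4 * j + 2" by (metis mult_div_mod_eq)
  then show ?thesis by (simp only: power_add power_mult) simp
qed

lemma doubly_even_extends_to_self_dual:
  fixes C :: "(bit ^ 'n) set"
  assumes "linear_code C" "doubly_even C" "8 dvd CARD('n)"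
  obtains D where "C \<subseteq> D" "self_dual_code D" "doubly_even D"
proof -
  define \<A> where "\<A> = {D. linear_code D \<and> doubly_even D \<and> C \<subseteq> D}"
  have "finite \<A>" "C \<in> \<A>" using assms by (auto simp: \<A>_def)
  then obtain D where "D \<in> \<A>" and max: "\<And>E. E \<in> \<A> \<Longrightarrow> D \<subseteq> E \<Longrightarrow> D = E"
    using finite_has_maximal2[of \<A> C] by blast
  then have D: "linear_code D" "doubly_even D" "C \<subseteq> D" by (auto simp: \<A>_def)
  have zero: "0 \<in> D" using D(1) by (simp add: linear_code_iff)
  have sub: "D \<subseteq> dual_code D" by (rule doubly_even_subset_dual_code[OF D(1,2)])
  \<comment> \<open>Maximality: a dual word of weight divisible by 4 could be adjoined to
    \<open>D\<close>.\<close>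
  have closed: "x \<in> D" if x: "x \<in> dual_code D" "4 dvd hamming_weight x" for x
  proof -
    have "D \<union> (+) x ` D \<in> \<A>" using doubly_even_extend[OF D(1,2) x] D(3) by (auto simp: \<A>_def)
    then have "D = D \<union> (+) x ` D" by (intro max) auto
    moreover have "x \<in> (+) x ` D" using zero by (intro image_eqI[of _ _ 0]) auto
    ultimately show ?thesis by blast
  qed
  \<comment> \<open>Orthogonality to the all-one word will force even weight on every word of the
    dual.\<close>
  have one: "1 \<in> D"
  proof (rule closed)
    show "1 \<in> dual_code D" by (rule one_in_dual_code[OF D(2)])
    show "4 dvd hamming_weight (1 :: bit ^ 'n)"
      using dvd_trans[of 4 8, OF _ assms(3)] by (simp add: hamming_weight_one)
  qed
  have i_D: "\<i> ^ hamming_weight x = 1" if "x \<in> D" for x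
  proof -
    obtain j where "hamming_weight x = 4 * j" using D(2) \<open>x \<in> D\<close> by (meson doubly_even_def dvdE)
    then show ?thesis by (simp only: power_mult) simp
  qed
  have i_dual: "\<i> ^ hamming_weight x = -1" if x: "x \<in> dual_code D - D" for x
  proof -
    have "std_inner 1 x = 0" using x one by (auto simp: dual_code_def std_inner_commute)
    then have "even (hamming_weight x)" by (simp add: std_inner_one_bit split: if_splits)
    moreover have "\<not> 4 dvd hamming_weight x" using closed x by blast
    ultimately have "hamming_weight x mod 4 = 2" by presburger
    then show ?thesis by (rule i_power_eq_neg_one)
  qed
  have "(\<Sum>x\<in>dual_code D. \<i> ^ hamming_weight x) =
      (\<Sum>x\<in>dual_code D - D. \<i> ^ hamming_weight x) + (\<Sum>x\<in>D. \<i> ^ hamming_weight x)"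
    by (rule sum.subset_diff) (use sub in auto)
  also have "\<dots> = of_nat (card D) - of_nat (card (dual_code D - D))"
    using i_D i_dual by simp
  finally have lhs: "(\<Sum>x\<in>dual_code D. \<i> ^ hamming_weight x) =
    of_nat (card D) - of_nat (card (dual_code D - D))" .
  \<comment> \<open>Since \<open>1 - \<i>\<close> and \<open>1 + \<i>\<close> have the same fourth
    power and weights in \<open>D\<close> are multiples of 4, every summand equals the n-th power of
    \<open>1 + \<i>\<close>. This is a positive number because 8 divides the length.\<close>
  have summand: "(1 - \<i>) ^ hamming_weight u * (1 + \<i>) ^ (CARD('n) - hamming_weight u) =
      16 ^ (CARD('n) div 8)" if u: "u \<in> D" for u
  proof -
    have p4: "(1 - \<i>) ^ 4 = -4" "(1 + \<i>) ^ 4 = -4"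
      by (simp_all add: complex_eq_iff power4_eq_xxxx algebra_simps)
    obtain j where j: "hamming_weight u = 4 * j" using D(2) u by (meson doubly_even_def dvdE)
    have "(1 - \<i>) ^ hamming_weight u = (1 + \<i>) ^ hamming_weight u"
      by (simp only: j power_mult p4)
    then have "(1 - \<i>) ^ hamming_weight u * (1 + \<i>) ^ (CARD('n) - hamming_weight u) =
        (1 + \<i>) ^ (8 * (CARD('n) div 8))"
      using assms(3) hamming_weight_le[of u] by (simp flip: power_add)
    also have "(1 + \<i>) ^ 8 = 16"
      using power_mult[of "1 + \<i>" 4 2] by (simp add: p4)
    then have "(1 + \<i>) ^ (8 * (CARD('n) div 8)) = 16 ^ (CARD('n) div 8)"
      by (simp only: power_mult)
    finally show ?thesis .
  qed
  have cD: "card D > 0" using zero by (auto simp: card_gt_0_iff)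
  have "of_nat (card D) * (of_nat (card D) - of_nat (card (dual_code D - D)) :: complex) =
      of_nat (card D) * 16 ^ (CARD('n) div 8)"
    unfolding lhs[symmetric] macwilliams[OF D(1)] by (simp add: summand)
  then have "of_nat (card D) - of_nat (card (dual_code D - D)) = (16 :: complex) ^ (CARD('n) div 8)"
    using zero mult_left_cancel[of "of_nat (card D) :: complex"] by auto
  then have "(of_nat (card D) :: complex) = of_nat (card (dual_code D - D)) + 16 ^ (CARD('n) div 8)"
    by (simp only: diff_eq_eq add.commute)
  also have "\<dots> = of_nat (card (dual_code D - D) + 16 ^ (CARD('n) div 8))" by simp
  finally have card: "card (dual_code D - D) < card D"
    by (simp only: of_nat_eq_iff) simp
  have "dual_code D \<subseteq> D"
  proof (rule subsetI, rule ccontr)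
    fix x assume x: "x \<in> dual_code D" "x \<notin> D"
    \<comment> \<open>A single such \<open>x\<close> brings in its whole coset, which has as many
      words as \<open>D\<close>, against the strict inequality \<open>card\<close>.\<close>
    have "(+) x ` D \<subseteq> dual_code D - D"
    proof clarify
      fix u assume u: "u \<in> D"
      have "x + u \<in> dual_code D"
        using x(1) u sub linear_dual_code[of D] unfolding linear_code_iff by blast
      moreover have "x + u \<notin> D"
      proof
        assume "x + u \<in> D"
        then have "(x + u) + u \<in> D" using u D(1) by (simp only: binary_linear_code_iff)
        with x(2) show False by (simp add: add.assoc)
      qed
      ultimately show "x + u \<in> dual_code D - D" by blast
    qed
    then have "card ((+) x ` D) \<le> card (dual_code D - D)" by (intro card_mono) auto
    moreover have "card ((+) x ` D) = card D" by (intro card_image) simp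
    ultimately show False using card by simp
  qed
  with sub D that show ?thesis by (auto simp: self_dual_code_def)
qed

section \<open>Delsarte's bound on the covering radius\<close>

text \<open>The MacWilliams transform of a word of weight \<open>w\<close>; its coefficients are
  values of Krawtchouk polynomials at \<open>w\<close>.\<close>

definition weight_fps :: "nat \<Rightarrow> nat \<Rightarrow> real fps" where
  "weight_fps n w = (1 - fps_X) ^ w * (1 + fps_X) ^ (n - w)"

text \<open>The adjacency operator of the Hamming cube, acting on weight enumerators: y^j goes to j
  y^(j-1) + (n-j) y^(j+1), and a word of weight j has j neighbours of weight j-1 and n-j of weight
  j+1.\<close>

definition weight_op :: "nat \<Rightarrow> real fps \<Rightarrow> real fps" where
  "weight_op n f = (1 - fps_X ^ 2) * fps_deriv f + of_nat n * fps_X * f"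

lemma mult_fps_deriv_power:
  "(a :: 'a::comm_ring_1 fps) * fps_deriv (a ^ m) = of_nat m * fps_deriv a * a ^ m"
  by (induction m) (simp_all add: algebra_simps)

lemma weight_op_weight_fps:
  assumes "w \<le> n"
  shows "weight_op n (weight_fps n w) = (of_nat n - 2 * of_nat w) * weight_fps n w"
proof -
  define a b :: "real fps" where "a = 1 - fps_X" and "b = 1 + fps_X"
  \<comment> \<open>Since \<open>1 - fps_X ^ 2 = a * b\<close>, each differentiated power gets back
    the factor it lost.\<close>
  have "(1 - fps_X ^ 2) * fps_deriv (a ^ w * b ^ (n - w)) =
      b * b ^ (n - w) * (a * fps_deriv (a ^ w)) + a * a ^ w * (b * fps_deriv (b ^ (n - w)))"
    by (simp add: a_def b_def algebra_simps power2_eq_square)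
  also have "\<dots> = (of_nat (n - w) * a - of_nat w * b) * (a ^ w * b ^ (n - w))"
    unfolding mult_fps_deriv_power by (simp add: a_def b_def algebra_simps)
  finally have "weight_op n (weight_fps n w) =
      (of_nat (n - w) * a - of_nat w * b + of_nat n * fps_X) * weight_fps n w"
    by (simp add: weight_op_def weight_fps_def a_def b_def algebra_simps)
  also have "of_nat (n - w) * a - of_nat w * b + of_nat n * fps_X = of_nat n - 2 * of_nat w"
    using assms by (simp add: a_def b_def of_nat_diff algebra_simps)
  finally show ?thesis .
qed

lemma weight_op_add: "weight_op n (f + g) = weight_op n f + weight_op n g"
  by (simp add: weight_op_def algebra_simps)

lemma weight_op_const_mult: "weight_op n (fps_const c * f) = fps_const c * weight_op n f"
  by (simp add: weight_op_def algebra_simps)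

lemma weight_op_sum:
  assumes "finite A"
  shows "weight_op n (\<Sum>u\<in>A. fps_const (c u) * f u) = (\<Sum>u\<in>A. fps_const (c u) * weight_op n (f u))"
  using assms
  by (induction A rule: finite_induct) (simp_all add: weight_op_add weight_op_const_mult, simp add: weight_op_def)

lemma fps_X_power_dvd_weight_op:
  assumes "fps_X ^ Suc m dvd f"
  shows "fps_X ^ m dvd weight_op n f"
proof -
  obtain g where f: "f = fps_X ^ Suc m * g" using assms by (auto simp: dvd_def)
  have X: "fps_deriv (fps_X ^ Suc m :: real fps) = of_nat (Suc m) * fps_X ^ m"
    unfolding fps_deriv_power diff_Suc_1 fps_of_nat by simp
  have "weight_op n f = fps_X ^ m * ((1 - fps_X ^ 2) * (of_nat (Suc m) * g + fps_X * fps_deriv g) +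
      of_nat n * fps_X ^ 2 * g)"
    unfolding weight_op_def f fps_deriv_mult X
    by (simp add: algebra_simps power2_eq_square del: of_nat_Suc)
  then show ?thesis by (metis dvd_triv_left)
qed

text \<open>For each \<open>s\<close> in \<open>S\<close>, the operator \<open>weight_op n\<close>
  minus its eigenvalue n - 2s multiplies the summand of \<open>u\<close> by 2(s - w u), the
  difference of two eigenvalues, and costs one factor \<open>fps_X\<close>.\<close>

lemma fps_X_power_dvd_annihilate:
  fixes w :: "'b \<Rightarrow> nat"
  assumes "finite S" "finite A" "\<And>u. u \<in> A \<Longrightarrow> w u \<le> n"
    and "fps_X ^ (card S + m) dvd (\<Sum>u\<in>A. fps_const (c u) * weight_fps n (w u))"
  shows "fps_X ^ m dvd
    (\<Sum>u\<in>A. fps_const (c u * (\<Prod>s\<in>S. 2 * (real s - real (w u)))) * weight_fps n (w u))"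
  using assms(1,4)
proof (induction S arbitrary: m rule: finite_induct)
  case empty
  then show ?case by simp
next
  case (insert s S)
  define c' where "c' u = c u * (\<Prod>s\<in>S. 2 * (real s - real (w u)))" for u
  let ?g = "\<Sum>u\<in>A. fps_const (c' u) * weight_fps n (w u)"
  have dvd: "fps_X ^ Suc m dvd ?g"
    using insert unfolding c'_def by (intro insert.IH) simp_all
  have eig: "weight_op n (weight_fps n (w u)) = fps_const (real n - 2 * real (w u)) * weight_fps n (w u)"
    if "u \<in> A" for u
    using weight_op_weight_fps[OF assms(3)[OF that]]
    by (simp add: fps_of_nat[symmetric] fps_numeral_fps_const flip: fps_const_sub fps_const_mult)
  have "weight_op n ?g - fps_const (real n - 2 * real s) * ?g =
      (\<Sum>u\<in>A. fps_const (c' u * (2 * (real s - real (w u)))) * weight_fps n (w u))"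
    unfolding weight_op_sum[OF assms(2)] sum_distrib_left sum_subtractf[symmetric]
    by (intro sum.cong refl)
      (simp add: eig algebra_simps flip: fps_const_sub fps_const_mult fps_const_add)
  moreover have "fps_X ^ m dvd weight_op n ?g - fps_const (real n - 2 * real s) * ?g"
    using dvd by (intro dvd_diff fps_X_power_dvd_weight_op dvd_mult dvd_power_le[OF dvd_refl, THEN dvd_trans, of m "Suc m"]) simp_all
  ultimately show ?case
    using insert by (simp add: c'_def mult_ac)
qed

text \<open>Here \<open>W\<close> may be any finite set of positive numbers covering the nonzero
  weights. If all weights in the coset exceeded \<open>card W\<close>, annihilating the weights in
  \<open>W\<close> would leave only the summand of the zero word, still divisible by
  \<open>fps_X\<close> although its constant term is nonzero.\<close>

lemma covering_radius_le:
  fixes D :: "(bit ^ 'n) set"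
  assumes D: "self_dual_code D" and W: "finite W" "0 \<notin> W" "hamming_weight ` (D - {0}) \<subseteq> W"
  shows "\<exists>x\<in>D. hamming_weight (x + v) \<le> card W"
proof (rule ccontr)
  assume "\<not> ?thesis"
  then have large: "card W + 1 \<le> hamming_weight (x + v)" if "x \<in> D" for x
    using that by (auto simp: not_le Suc_le_eq)
  have lin: "linear_code D" and dual: "dual_code D = D"
    using D by (simp_all add: self_dual_code_def)
  have zero: "0 \<in> D" using lin by (simp add: linear_code_iff)
  have "(chi b :: real fps) = fps_const (chi b)" for b
    by (simp add: chi_def flip: fps_const_neg)
  then have "of_nat (card D) * (\<Sum>x\<in>D. fps_X ^ hamming_weight (x + v)) =
      (\<Sum>u\<in>D. fps_const (chi (std_inner u v)) * weight_fps (CARD('n)) (hamming_weight u))"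
    using macwilliams_coset[OF lin, of "fps_X :: real fps" v] by (simp add: dual weight_fps_def)
  \<comment> \<open>One power more than \<open>W\<close> has elements, so that one survives the
    annihilation.\<close>
  moreover have "fps_X ^ (card W + 1) dvd (of_nat (card D) *
      (\<Sum>x\<in>D. fps_X ^ hamming_weight (x + v)) :: real fps)"
    by (intro dvd_mult dvd_sum le_imp_power_dvd large)
  ultimately have "fps_X ^ 1 dvd (\<Sum>u\<in>D. fps_const (chi (std_inner u v) *
      (\<Prod>s\<in>W. 2 * (real s - real (hamming_weight u)))) * weight_fps (CARD('n)) (hamming_weight u))"
    by (intro fps_X_power_dvd_annihilate W) (auto simp: hamming_weight_le)
  also have "(\<Sum>u\<in>D. fps_const (chi (std_inner u v) *
      (\<Prod>s\<in>W. 2 * (real s - real (hamming_weight u)))) * weight_fps (CARD('n)) (hamming_weight u)) =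
    (\<Sum>u\<in>{0}. fps_const (chi (std_inner u v) *
      (\<Prod>s\<in>W. 2 * (real s - real (hamming_weight u)))) * weight_fps (CARD('n)) (hamming_weight u))"
  proof (rule sum.mono_neutral_right)
    show "\<forall>u\<in>D - {0}. fps_const (chi (std_inner u v) *
      (\<Prod>s\<in>W. 2 * (real s - real (hamming_weight u)))) * weight_fps (CARD('n)) (hamming_weight u) = 0"
    proof
      fix u assume "u \<in> D - {0}"
      then have "(\<Prod>s\<in>W. 2 * (real s - real (hamming_weight u))) = 0"
        using W by (intro prod_zero) auto
      then show "fps_const (chi (std_inner u v) *
        (\<Prod>s\<in>W. 2 * (real s - real (hamming_weight u)))) * weight_fps (CARD('n)) (hamming_weight u) = 0"
        by simp
    qed
  qed (use zero in auto)
  also have "\<dots> = fps_const (\<Prod>s\<in>W. 2 * real s) * (1 + fps_X) ^ CARD('n)"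
    by (simp add: std_inner_def weight_fps_def)
  finally obtain g where "fps_const (\<Prod>s\<in>W. 2 * real s) * (1 + fps_X) ^ CARD('n) = fps_X ^ 1 * g"
    by (rule dvdE)
  from arg_cong[OF this, of "\<lambda>f. fps_nth f 0"] have "(\<Prod>s\<in>W. 2 * real s) = 0"
    by (simp add: fps_power_zeroth)
  then show False
    using W by auto
qed

section \<open>The Mallows-Sloane bound in length 24k+8\<close>

text \<open>Up to a constant factor the argument is the derivative of a power of \<open>z\<close>,
  and derivatives have no residue. The exponent j - N is at most -2, which excludes the logarithmic
  derivative.\<close>

lemma fls_residue_power_deriv_eq_0:
  fixes z :: "'a::field_char_0 fls"
  assumes "j + 2 \<le> N"
  shows "fls_residue (z ^ j * inverse z ^ N * fls_deriv z) = 0"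
proof (cases "z = 0")
  case False
  obtain M where N: "N = j + Suc (Suc M)"
    using le_Suc_ex[OF assms] by auto
  have "fls_deriv (inverse z ^ Suc M) =
      - (of_nat (Suc M) * (inverse z ^ Suc (Suc M) * fls_deriv z))"
    by (simp only: fls_deriv_power diff_Suc_1 fls_inverse_deriv)
      (simp add: power2_eq_square algebra_simps)
  then have "fls_residue (of_int (int (Suc M)) * (inverse z ^ Suc (Suc M) * fls_deriv z)) = 0"
    using fls_residue_deriv[of "inverse z ^ Suc M"]
    by (simp only: of_int_of_nat_eq fls_residue_def fls_uminus_nth neg_equal_0_iff_equal)
  then have "fls_residue (inverse z ^ Suc (Suc M) * fls_deriv z) = 0"
    unfolding fls_residue_of_int_times mult_eq_0_iff of_int_eq_0_iff
    by (elim disjE) (simp_all only: of_nat_eq_0_iff nat.distinct)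
  moreover have "z ^ j * inverse z ^ N = inverse z ^ Suc (Suc M)"
    unfolding N power_add using False by (simp add: power_inverse)
  ultimately show ?thesis by (simp only:)
qed simp

text \<open>
  Writing \<open>z = \<rho> - 1\<close>, the argument of the residue is a linear combination of the
  derivatives of the powers \<open>z\<^sup>i\<close> with \<open>i < 0\<close>.
\<close>

lemma fls_residue_shifted_power_deriv_eq_0:
  fixes \<rho> :: "'a::field_char_0 fls"
  assumes "e + 2 \<le> N"
  shows "fls_residue (\<rho> ^ e * inverse (\<rho> - 1) ^ N * fls_deriv \<rho>) = 0"
proof -
  define z where "z = \<rho> - 1"
  have "\<rho> ^ e * inverse z ^ N * fls_deriv z =
      (\<Sum>j\<le>e. of_int (int (e choose j)) * (z ^ j * inverse z ^ N * fls_deriv z))"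
    using binomial_ring[of z 1 e] by (simp add: z_def sum_distrib_right mult.assoc)
  moreover have "fls_residue (of_int (int (e choose j)) * (z ^ j * inverse z ^ N * fls_deriv z)) = 0"
    if "j \<le> e" for j
    unfolding fls_residue_of_int_times using assms that
    by (subst fls_residue_power_deriv_eq_0) simp_all
  ultimately show ?thesis
    by (simp add: fls_nth_sum z_def)
qed

section \<open>Removing the weights 0 and n from the transformed weight enumerator\<close>

lemma weight_op_1: "weight_op n 1 = fps_const (real n) * fps_X"
  by (simp add: weight_op_def fps_of_nat)

text \<open>The main term, coming from the constant term 1 of the weight enumerator: L 1 = n y and L
  (n y) = n (1 + (n - 1) y^2), where L is \<open>weight_op n\<close>.\<close>

lemma weight_op_weight_op_1:
  "of_nat n ^ 2 - weight_op n (weight_op n 1) = fps_const (real n * (real n - 1)) * (1 - fps_X ^ 2)"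
  unfolding weight_op_1 weight_op_const_mult
  by (simp add: weight_op_def algebra_simps power2_eq_square flip: fps_of_nat fps_const_mult fps_const_sub)

text \<open>By MacWilliams and self-duality, the sum of the \<open>weight_fps\<close> is
  \<open>card D\<close> times the weight enumerator. Applying n^2 - L^2 to it produces the factors
  n^2 - (n - 2w)^2 = 4w(n - w). The two applications of L cost two powers of \<open>fps_X\<close>,
  hence \<open>m + 2\<close> in the hypothesis.\<close>

lemma weight_product_sum_dvd:
  fixes D :: "(bit ^ 'n) set"
  assumes D: "self_dual_code D" and min: "\<And>x. x \<in> D \<Longrightarrow> x \<noteq> 0 \<Longrightarrow> m + 2 \<le> hamming_weight x"
  defines "n \<equiv> CARD('n)"
  shows "fps_X ^ m dvd
    (\<Sum>u\<in>D. fps_const (4 * real (hamming_weight u) * real (n - hamming_weight u)) *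
      weight_fps n (hamming_weight u)) -
    fps_const (real (card D) * real n * (real n - 1)) * (1 - fps_X ^ 2)"
proof -
  let ?w = "hamming_weight :: bit ^ 'n \<Rightarrow> nat"
  let ?S = "\<Sum>u\<in>D. weight_fps n (?w u)"
  have lin: "linear_code D" and dual: "dual_code D = D"
    using D by (simp_all add: self_dual_code_def)
  have zero: "0 \<in> D" using lin by (simp add: linear_code_iff)
  define E :: "real fps" where "E = (\<Sum>x\<in>D - {0}. fps_X ^ ?w x)"
  have E: "fps_X ^ (m + 2) dvd E"
    unfolding E_def by (intro dvd_sum le_imp_power_dvd min) auto
  have "(\<Sum>x\<in>D. fps_X ^ ?w x) = 1 + E"
    unfolding E_def using zero by (subst sum.remove[of _ 0]) auto
  then have S: "?S = fps_const (real (card D)) * (1 + E)"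
    using macwilliams[OF lin, of "fps_X :: real fps"]
    by (simp add: dual weight_fps_def n_def fps_of_nat)
  have eig: "weight_op n (weight_fps n (?w u)) =
      fps_const (real n - 2 * real (?w u)) * weight_fps n (?w u)" for u
    using weight_op_weight_fps[OF hamming_weight_le[of u]]
    by (simp add: n_def fps_of_nat[symmetric] fps_numeral_fps_const flip: fps_const_sub fps_const_mult)
  have "weight_op n (weight_op n ?S) =
      (\<Sum>u\<in>D. fps_const ((real n - 2 * real (?w u)) ^ 2) * weight_fps n (?w u))"
    using weight_op_sum[of D n "\<lambda>_. 1" "\<lambda>u. weight_fps n (?w u)"]
      weight_op_sum[of D n "\<lambda>u. real n - 2 * real (?w u)" "\<lambda>u. weight_fps n (?w u)"]
    by (simp add: eig power2_eq_square mult.assoc[symmetric] del: fps_const_sub)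
  then have "of_nat n ^ 2 * ?S - weight_op n (weight_op n ?S) =
      (\<Sum>u\<in>D. (fps_const (real n ^ 2) - fps_const ((real n - 2 * real (?w u)) ^ 2)) *
        weight_fps n (?w u))"
    by (simp add: sum_distrib_left left_diff_distrib sum_subtractf fps_const_power flip: fps_of_nat
      del: fps_const_sub)
  also have "\<dots> = (\<Sum>u\<in>D. fps_const (4 * real (?w u) * real (n - ?w u)) * weight_fps n (?w u))"
    by (intro sum.cong refl)
      (simp add: n_def hamming_weight_le of_nat_diff power2_eq_square algebra_simps)
  finally have lhs: "(\<Sum>u\<in>D. fps_const (4 * real (?w u) * real (n - ?w u)) * weight_fps n (?w u)) =
      of_nat n ^ 2 * ?S - weight_op n (weight_op n ?S)" ..
  have "of_nat n ^ 2 * ?S - weight_op n (weight_op n ?S) =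
      fps_const (real (card D)) * (of_nat n ^ 2 - weight_op n (weight_op n 1)) +
      fps_const (real (card D)) * (of_nat n ^ 2 * E - weight_op n (weight_op n E))"
    unfolding S weight_op_const_mult weight_op_add by (simp add: algebra_simps)
  also have "fps_const (real (card D)) * (of_nat n ^ 2 - weight_op n (weight_op n 1)) =
      fps_const (real (card D) * real n * (real n - 1)) * (1 - fps_X ^ 2)"
    unfolding weight_op_weight_op_1 by (simp add: mult.assoc[symmetric] del: fps_const_sub)
  finally have "(\<Sum>u\<in>D. fps_const (4 * real (?w u) * real (n - ?w u)) * weight_fps n (?w u)) -
      fps_const (real (card D) * real n * (real n - 1)) * (1 - fps_X ^ 2) =
      fps_const (real (card D)) * (of_nat n ^ 2 * E - weight_op n (weight_op n E))"
    unfolding lhs by simp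
  moreover have "fps_X ^ m dvd E"
    using E by (rule dvd_trans[rotated]) (simp add: le_imp_power_dvd)
  moreover have "fps_X ^ m dvd weight_op n (weight_op n E)"
    using E by (intro fps_X_power_dvd_weight_op) simp
  ultimately show ?thesis by (simp add: dvd_diff dvd_mult)
qed

section \<open>Positivity of power series coefficients\<close>

definition fps_nonneg :: "real fps \<Rightarrow> bool" where
  "fps_nonneg f \<longleftrightarrow> (\<forall>i. fps_nth f i \<ge> 0)"

lemma fps_nonneg_mult: "fps_nonneg f \<Longrightarrow> fps_nonneg g \<Longrightarrow> fps_nonneg (f * g)"
  by (simp add: fps_nonneg_def fps_mult_nth sum_nonneg)

lemma fps_nonneg_add: "fps_nonneg f \<Longrightarrow> fps_nonneg g \<Longrightarrow> fps_nonneg (f + g)"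
  by (simp add: fps_nonneg_def)

lemma fps_nonneg_1: "fps_nonneg 1"
  by (simp add: fps_nonneg_def)

lemma fps_nonneg_X_power: "fps_nonneg (fps_X ^ m)"
  by (simp add: fps_nonneg_def fps_X_power_nth)

lemma fps_nonneg_numeral: "fps_nonneg (numeral a)"
  by (simp add: fps_nonneg_def fps_numeral_nth)

lemma fps_nonneg_power: "fps_nonneg f \<Longrightarrow> fps_nonneg (f ^ m)"
  by (induction m) (simp_all add: fps_nonneg_1 fps_nonneg_mult)

text \<open>In the convolution the term of index 0 is positive, and no other term is
  negative.\<close>

lemma fps_mult_nth_pos:
  assumes "fps_nonneg f" "fps_nonneg g" "fps_nth f 0 > 0" "fps_nth g m > 0"
  shows "fps_nth (f * g) m > 0"
proof -
  have "0 < fps_nth f 0 * fps_nth g (m - 0)" using assms by simp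
  also have "\<dots> \<le> (\<Sum>i=0..m. fps_nth f i * fps_nth g (m - i))"
    using assms by (intro member_le_sum) (auto simp: fps_nonneg_def)
  finally show ?thesis by (simp add: fps_mult_nth)
qed

lemma fps_inverse_one_minus_X_power_4:
  "inverse (1 - fps_X ^ 4 :: real fps) = Abs_fps (\<lambda>i. if 4 dvd i then 1 else 0)"
proof (rule fps_inverse_unique)
  have "4 dvd i - 4 \<longleftrightarrow> 4 dvd i" if "4 \<le> i" for i :: nat
    using that by presburger
  moreover have "i = 0" if "i < 4" "4 dvd i" for i :: nat
    using that by presburger
  ultimately show "(1 - fps_X ^ 4) * Abs_fps (\<lambda>i. if 4 dvd i then 1 else 0) = (1 :: real fps)"
    by (auto simp: fps_eq_iff left_diff_distrib fps_X_power_mult_nth not_less)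
qed

text \<open>Up to a positive constant this is the factor of \<open>C\<close> in the residue computed
  for \<open>weight_gap_identity\<close>. The geometric series in y^4 has coefficient 1 at y^(4k),
  and all remaining factors have nonnegative coefficients and constant term 1.\<close>

lemma residue_coefficient_pos:
  "fps_nth ((1 + 6 * fps_X ^ 2 + fps_X ^ 4) * (1 + fps_X ^ 2) ^ 3 *
    inverse (1 - fps_X ^ 4 :: real fps) ^ (4 * k + 4)) (4 * k) > 0"
proof -
  let ?g = "inverse (1 - fps_X ^ 4 :: real fps)"
  have g: "fps_nonneg ?g" "fps_nth ?g 0 > 0" "fps_nth ?g (4 * k) > 0"
    unfolding fps_inverse_one_minus_X_power_4 by (simp_all add: fps_nonneg_def)
  have "fps_nth (?g ^ (4 * k + 3) * ?g) (4 * k) > 0"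
    by (rule fps_mult_nth_pos) (use g in \<open>simp_all add: fps_nonneg_power fps_power_zeroth\<close>)
  moreover have "?g ^ (4 * k + 3) * ?g = ?g ^ (4 * k + 4)"
    using power_add[of ?g "4 * k + 3" 1] by (simp add: add.commute[of 4])
  ultimately have pos: "fps_nth (?g ^ (4 * k + 4)) (4 * k) > 0"
    by (simp only:)
  show ?thesis
  proof (rule fps_mult_nth_pos[OF _ _ _ pos])
    show "fps_nonneg ((1 + 6 * fps_X ^ 2 + fps_X ^ 4) * (1 + fps_X ^ 2) ^ 3)"
      by (intro fps_nonneg_mult fps_nonneg_add fps_nonneg_1 fps_nonneg_X_power
        fps_nonneg_numeral fps_nonneg_power)
    show "fps_nonneg (?g ^ (4 * k + 4))" by (intro fps_nonneg_power g)
  qed (simp add: fps_power_zeroth)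
qed

section \<open>The residue computation with Laurent series\<close>

lemma fps_to_fls_sum: "fps_to_fls (sum f A) = (\<Sum>x\<in>A. fps_to_fls (f x))"
  by (induction A rule: infinite_finite_induct) simp_all

lemma fls_residue_X_inv_power_mult:
  "fls_residue (inverse fls_X ^ Suc m * fps_to_fls f) = fps_nth (f :: real fps) m"
  by (simp add: fls_inverse_X fls_X_inv_power_times_conv_shift del: power_Suc)

text \<open>To be read with \<open>a\<close> = 1 - y, \<open>b\<close> = 1 + y, \<open>P\<close> = 1
  + 6y^2 + y^4 and \<open>Q\<close> = 1 + y^2, so that \<open>a * b * Q\<close> is 1 - y^4. Treating
  these as independent reduces the identity to a comparison of exponents.\<close>

lemma kernel_identity:
  fixes a b y P Q :: "'a::field_char_0"
  assumes "a \<noteq> 0" "b \<noteq> 0" "y \<noteq> 0" "Q \<noteq> 0"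
  shows "inverse (b ^ (4 * k + 8) * a ^ (20 * k)) *
      ((2 * P * inverse a ^ 4) * inverse (8 * y * Q * inverse a ^ 4) ^ Suc (4 * k) * (8 * b ^ 3 * inverse a ^ 5)) =
    (16 * inverse 8 ^ Suc (4 * k)) *
      (inverse y ^ Suc (4 * k) * (P * Q ^ 4 * inverse (a * b * Q) ^ (4 * k + 5)))"
proof -
  define m where "m = 4 * k"
  have a: "a ^ (20 * k) = (a ^ 5) ^ m" by (simp add: m_def flip: power_mult)
  show ?thesis
    unfolding a m_def[symmetric] using assms
    by (simp add: field_simps power_mult_distrib power_mult[symmetric] mult.commute[of _ m] flip: power_add)
      (simp add: power_add power_mult eval_nat_numeral mult_ac)
qed

text \<open>The coefficients \<open>c\<close> are arbitrary because only their zeros matter: weights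
  outside the range from 4k + 8 to 20k may occur, with coefficient 0.\<close>

lemma weight_gap_identity:
  fixes w :: "'b \<Rightarrow> nat" and c :: "'b \<Rightarrow> real"
  assumes "finite A"
    and w: "\<And>u. u \<in> A \<Longrightarrow> c u \<noteq> 0 \<Longrightarrow> 4 dvd w u \<and> 4 * k + 8 \<le> w u \<and> w u \<le> 20 * k"
    and dvd: "fps_X ^ Suc (4 * k) dvd
      (\<Sum>u\<in>A. fps_const (c u) * weight_fps (24 * k + 8) (w u)) - fps_const C * (1 - fps_X ^ 2)"
  shows "C = 0"
proof -
  define F where "F = (\<Sum>u\<in>A. fps_const (c u) * weight_fps (24 * k + 8) (w u))"
  obtain G where F: "F = fps_const C * (1 - fps_X ^ 2) + fps_X ^ Suc (4 * k) * G"
    using dvd by (auto simp: F_def dvd_def algebra_simps simp del: power_Suc)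
  define y a b \<rho> :: "real fls" where "y = fls_X" and "a = 1 - y" and "b = 1 + y"
    and "\<rho> = (b * inverse a) ^ 4"
  have nth: "fls_nth a 0 = 1" "fls_nth b 0 = 1" "fls_nth (1 + y ^ 2) 0 = 1"
    by (simp_all add: a_def b_def y_def)
  have nz: "a \<noteq> 0" "b \<noteq> 0" "1 + y ^ 2 \<noteq> 0" "y \<noteq> 0"
    using nth by (metis fls_zero_nth zero_neq_one, metis fls_zero_nth zero_neq_one,
      metis fls_zero_nth zero_neq_one) (simp add: y_def)
  \<comment> \<open>Inverse of the summand of the largest admissible weight 20k; multiplication by
    \<open>T\<close> turns weight 20k - 4e into \<open>\<rho> ^ e\<close>.\<close>
  define T where "T = inverse (b ^ (4 * k + 8) * a ^ (20 * k))"
  \<comment> \<open>As \<open>\<rho> - 1\<close> has a simple zero at y = 0, the kernel extracts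
    information up to y^(4k). The factor \<open>\<rho> + 1\<close> contributes the power of
    \<open>a\<close> needed to give \<open>a\<close> and \<open>b\<close> the same exponent in
    \<open>T * K\<close>.\<close>
  define K where "K = (\<rho> + 1) * inverse (\<rho> - 1) ^ Suc (4 * k) * fls_deriv \<rho>"
  have ab: "a = fps_to_fls (1 - fps_X)" "b = fps_to_fls (1 + fps_X)"
    by (simp_all add: a_def b_def y_def)

  \<comment> \<open>Here e is at most 4k - 2, so even after multiplication by
    \<open>\<rho> + 1\<close> the exponents stay at least two below the pole order 4k + 1.\<close>
  have "fls_residue (T * fps_to_fls (fps_const (c u) * weight_fps (24 * k + 8) (w u)) * K) = 0"
    if u: "u \<in> A" for u
  proof (cases "c u = 0")
    case False
    with w u have wu: "4 dvd w u" "4 * k + 8 \<le> w u" "w u \<le> 20 * k" by auto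
    then obtain e where e: "20 * k = w u + 4 * e"
      by (metis dvd_diff_nat dvd_def dvd_triv_left le_add_diff_inverse mult.assoc num_double numeral_times_numeral)
    then have e': "24 * k + 8 - w u = (4 * k + 8) + 4 * e" "e + 3 \<le> Suc (4 * k)"
      using wu by simp_all
    have cancel: "inverse (B * (A * A')) * (A * (B * B')) = B' * inverse A'"
      if "A \<noteq> 0" "B \<noteq> 0" for A A' B B' :: "real fls"
      using that by (simp add: field_simps)
    have "T * (a ^ w u * b ^ (24 * k + 8 - w u)) = b ^ (4 * e) * inverse (a ^ (4 * e))"
      unfolding T_def e e'(1) power_add by (rule cancel) (use nz in simp_all)
    also have "\<dots> = \<rho> ^ e"
      by (simp add: \<rho>_def power_mult power_mult_distrib power_inverse)
    finally have "T * (a ^ w u * b ^ (24 * k + 8 - w u)) = \<rho> ^ e" .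
    then have "T * fps_to_fls (fps_const (c u) * weight_fps (24 * k + 8) (w u)) * K =
        fls_const (c u) * \<rho> ^ e * K"
      by (simp add: weight_fps_def ab fls_times_fps_to_fls fps_to_fls_power mult_ac)
    also have "\<dots> = fls_const (c u) * (\<rho> ^ Suc e * inverse (\<rho> - 1) ^ Suc (4 * k) * fls_deriv \<rho> +
        \<rho> ^ e * inverse (\<rho> - 1) ^ Suc (4 * k) * fls_deriv \<rho>)"
      by (simp add: K_def algebra_simps)
    finally have "fls_residue (T * fps_to_fls (fps_const (c u) * weight_fps (24 * k + 8) (w u)) * K) =
        c u * (fls_residue (\<rho> ^ Suc e * inverse (\<rho> - 1) ^ Suc (4 * k) * fls_deriv \<rho>) +
          fls_residue (\<rho> ^ e * inverse (\<rho> - 1) ^ Suc (4 * k) * fls_deriv \<rho>))"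
      by (simp only: fls_residue_fls_const_times fls_residue_add)
    also have "\<dots> = 0"
      using e'(2) by (subst (1 2) fls_residue_shifted_power_deriv_eq_0) simp_all
    finally show ?thesis .
  qed simp
  then have res: "fls_residue (T * fps_to_fls F * K) = 0"
    unfolding F_def using assms(1)
    by (simp add: fps_to_fls_sum sum_distrib_left sum_distrib_right fls_nth_sum)
  have TK: "T * K = fls_const (16 * inverse 8 ^ Suc (4 * k)) * (inverse fls_X ^ Suc (4 * k) *
      fps_to_fls ((1 + 6 * fps_X ^ 2 + fps_X ^ 4) * (1 + fps_X ^ 2) ^ 4 *
        inverse (1 - fps_X ^ 4) ^ (4 * k + 5)))"
  proof -
    have "fls_deriv a = -1" "fls_deriv b = 1" by (simp_all add: a_def b_def y_def)
    then have "fls_deriv \<rho> = 4 * (b * inverse a) ^ 3 * (inverse a + b * inverse a ^ 2)"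
      unfolding \<rho>_def fls_deriv_power fls_deriv_mult fls_inverse_deriv by simp
    also have "inverse a + b * inverse a ^ 2 = 2 * inverse a ^ 2"
      using nz(1) by (simp add: field_simps power2_eq_square) (simp add: a_def b_def)
    finally have d: "fls_deriv \<rho> = 8 * b ^ 3 * inverse a ^ 5"
      by (simp add: power_mult_distrib eval_nat_numeral)
    have p: "\<rho> + 1 = 2 * (1 + 6 * y ^ 2 + y ^ 4) * inverse a ^ 4"
    proof -
      have "\<rho> + 1 = (b ^ 4 + a ^ 4) * inverse a ^ 4"
        using nz by (simp add: \<rho>_def power_mult_distrib field_simps)
      also have "b ^ 4 + a ^ 4 = 2 * (1 + 6 * y ^ 2 + y ^ 4)"
        unfolding a_def b_def by algebra
      finally show ?thesis .
    qed
    have z: "\<rho> - 1 = 8 * y * (1 + y ^ 2) * inverse a ^ 4"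
    proof -
      have "\<rho> - 1 = (b ^ 4 - a ^ 4) * inverse a ^ 4"
        using nz by (simp add: \<rho>_def power_mult_distrib field_simps)
      also have "b ^ 4 - a ^ 4 = 8 * y * (1 + y ^ 2)"
        unfolding a_def b_def by algebra
      finally show ?thesis .
    qed
    have g: "inverse (a * b * (1 + y ^ 2)) = fps_to_fls (inverse (1 - fps_X ^ 4))"
    proof -
      have "a * b * (1 + y ^ 2) = 1 - y ^ 4" unfolding a_def b_def by algebra
      also have "\<dots> = fps_to_fls (1 - fps_X ^ 4)" by (simp add: y_def fps_to_fls_power)
      finally show ?thesis
        by (simp only:) (subst fls_inverse_fps_to_fls; simp add: subdegree_eq_0)
    qed
    have "T * K = (16 * inverse 8 ^ Suc (4 * k)) *
      (inverse y ^ Suc (4 * k) * ((1 + 6 * y ^ 2 + y ^ 4) * (1 + y ^ 2) ^ 4 *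
        inverse (a * b * (1 + y ^ 2)) ^ (4 * k + 5)))"
      unfolding T_def K_def p z d by (rule kernel_identity) (use nz in auto)
    also have "16 * inverse 8 ^ Suc (4 * k) = fls_const (16 * inverse 8 ^ Suc (4 * k) :: real)"
      by (simp only: fls_const_mult_const[symmetric] fls_const_power fls_inverse_const[symmetric] fls_const_numeral)
    finally show ?thesis
      by (simp only: g) (simp add: y_def fls_times_fps_to_fls fps_to_fls_power del: power_Suc)
  qed
  have "T * fps_to_fls F * K = (T * K) * fps_to_fls F"
    by (simp only: mult_ac)
  also have "\<dots> = fls_const (16 * inverse 8 ^ Suc (4 * k)) * (inverse fls_X ^ Suc (4 * k) *
      fps_to_fls ((1 + 6 * fps_X ^ 2 + fps_X ^ 4) * (1 + fps_X ^ 2) ^ 4 *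
        inverse (1 - fps_X ^ 4) ^ (4 * k + 5) * F))"
    unfolding TK by (simp only: fls_times_fps_to_fls mult.assoc)
  finally have "fps_nth ((1 + 6 * fps_X ^ 2 + fps_X ^ 4) * (1 + fps_X ^ 2) ^ 4 *
        inverse (1 - fps_X ^ 4) ^ (4 * k + 5) * F) (4 * k) = 0"
    using res unfolding fls_residue_fls_const_times
    by (simp only: fls_residue_fls_const_times fls_residue_X_inv_power_mult) simp
  \<comment> \<open>One inverse of 1 - y^4 cancels 1 - y^2 from the main term together with one
    factor 1 + y^2. The part with \<open>G\<close> starts in degree 4k + 1 and does not reach the
    coefficient in question.\<close>
  moreover have "(1 + 6 * fps_X ^ 2 + fps_X ^ 4) * (1 + fps_X ^ 2) ^ 4 *
      inverse (1 - fps_X ^ 4) ^ (4 * k + 5) * F =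
      fps_const C * ((1 + 6 * fps_X ^ 2 + fps_X ^ 4) * (1 + fps_X ^ 2) ^ 3 *
        inverse (1 - fps_X ^ 4) ^ (4 * k + 4)) +
      fps_X ^ Suc (4 * k) * ((1 + 6 * fps_X ^ 2 + fps_X ^ 4) * (1 + fps_X ^ 2) ^ 4 *
        inverse (1 - fps_X ^ 4) ^ (4 * k + 5) * G)"
  proof -
    define g where "g = inverse (1 - fps_X ^ 4 :: real fps)"
    define P where "P = (1 + 6 * fps_X ^ 2 + fps_X ^ 4 :: real fps)"
    have "(1 - fps_X ^ 4) * g = 1"
      unfolding g_def by (rule inverse_mult_eq_1') simp
    moreover have "1 - fps_X ^ 4 = (1 + fps_X ^ 2) * (1 - fps_X ^ 2 :: real fps)" by algebra
    ultimately have g: "(1 + fps_X ^ 2) * (1 - fps_X ^ 2) * g = 1" by simp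
    have "P * (1 + fps_X ^ 2) ^ 4 * g ^ (4 * k + 5) * (fps_const C * (1 - fps_X ^ 2)) =
        fps_const C * (P * (1 + fps_X ^ 2) ^ 3 * g ^ (4 * k + 4)) *
        ((1 + fps_X ^ 2) * (1 - fps_X ^ 2) * g)"
    proof -
      have "g ^ (4 * k + 5) = g ^ (4 * k + 4) * g" "q ^ 4 = q ^ 3 * q" for q :: "real fps"
        by (simp_all add: eval_nat_numeral mult_ac)
      then show ?thesis by (simp only: mult_ac)
    qed
    then show ?thesis
      unfolding F g_def[symmetric] P_def[symmetric] g
      by (simp only: distrib_left mult_1_left mult_1_right mult_ac)
  qed
  ultimately have "C * fps_nth ((1 + 6 * fps_X ^ 2 + fps_X ^ 4) * (1 + fps_X ^ 2) ^ 3 *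
      inverse (1 - fps_X ^ 4) ^ (4 * k + 4)) (4 * k) = 0"
    by (simp add: fps_X_power_mult_nth del: power_Suc)
  with residue_coefficient_pos[of k] show ?thesis by simp
qed

section \<open>Residue codes of self-dual codes over the integers modulo 4\<close>

lemma doubly_even_self_dual_weight_le:
  fixes D :: "(bit ^ 'n) set"
  assumes D: "self_dual_code D" "doubly_even D"
    and min: "\<And>x. x \<in> D \<Longrightarrow> x \<noteq> 0 \<Longrightarrow> m \<le> hamming_weight x"
    and x: "x \<in> D" "hamming_weight x \<noteq> CARD('n)"
  shows "hamming_weight x + m \<le> CARD('n)"
proof -
  \<comment> \<open>The all-one word lies in \<open>D\<close>, so complementation turns the lower
    bound on weights into an upper bound.\<close>
  have "1 \<in> D" using one_in_dual_code[OF D(2)] D(1) by (simp add: self_dual_code_def)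
  then have "x + 1 \<in> D"
    using D(1) x(1) by (simp add: self_dual_code_def binary_linear_code_iff)
  moreover have "hamming_weight (x + 1) \<noteq> 0"
    using x(2) hamming_weight_le[of x] unfolding hamming_weight_add_one by linarith
  ultimately have "m \<le> hamming_weight (x + 1)"
    by (intro min) auto
  then show ?thesis
    using hamming_weight_le[of x] unfolding hamming_weight_add_one by linarith
qed

lemma mallows_sloane_24k_plus_8:
  fixes D :: "(bit ^ 'n) set"
  assumes n: "CARD('n) = 24 * k + 8" and D: "self_dual_code D" "doubly_even D"
  shows "\<exists>x\<in>D. x \<noteq> 0 \<and> hamming_weight x \<le> 4 * k + 4"
proof (rule ccontr)
  assume no_small: "\<not> ?thesis"
  have four: "4 dvd hamming_weight x" if "x \<in> D" for x
    using that D(2) by (simp add: doubly_even_def)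
  have min: "4 * k + 8 \<le> hamming_weight x" if x: "x \<in> D" "x \<noteq> 0" for x
  proof -
    have "4 * k + 4 < hamming_weight x" using no_small x by (auto simp: not_le)
    with four[OF x(1)] show ?thesis by presburger
  qed
  \<comment> \<open>These coefficients vanish at the weights 0 and n; all other weights lie between
    4k + 8 and, by complementation, 20k.\<close>
  let ?c = "\<lambda>u :: bit ^ 'n. 4 * real (hamming_weight u) * real (24 * k + 8 - hamming_weight u)"
  have "real (card D) * real (24 * k + 8) * (real (24 * k + 8) - 1) = 0"
  proof (rule weight_gap_identity[of D ?c hamming_weight k])
    show "finite D" by simp
    show "4 dvd hamming_weight u \<and> 4 * k + 8 \<le> hamming_weight u \<and> hamming_weight u \<le> 20 * k"
      if u: "u \<in> D" "?c u \<noteq> 0" for u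
    proof -
      from u(2) have "u \<noteq> 0" "hamming_weight u \<noteq> CARD('n)" by (auto simp: n)
      then show ?thesis
        using four[OF u(1)] min[OF u(1)] doubly_even_self_dual_weight_le[OF D min u(1)]
        by (simp add: n)
    qed
    show "fps_X ^ Suc (4 * k) dvd
      (\<Sum>u\<in>D. fps_const (?c u) * weight_fps (24 * k + 8) (hamming_weight u)) -
      fps_const (real (card D) * real (24 * k + 8) * (real (24 * k + 8) - 1)) * (1 - fps_X ^ 2)"
    proof (rule weight_product_sum_dvd[OF D(1), of "Suc (4 * k)", unfolded n])
      show "Suc (4 * k) + 2 \<le> hamming_weight x" if "x \<in> D" "x \<noteq> 0" for x
        using min[OF that] by simp
    qed
  qed
  moreover have "card D > 0"
    using D(1) by (auto simp: card_gt_0_iff self_dual_code_def linear_code_iff)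
  ultimately show False by simp
qed

section \<open>Arithmetic modulo 4 and residue codes\<close>

lemma self_dual_code_mem_iff:
  assumes "self_dual_code C"
  shows "x \<in> C \<longleftrightarrow> (\<forall>y\<in>C. std_inner x y = 0)"
proof -
  have "C = dual_code C" using assms by (simp add: self_dual_code_def)
  then have "x \<in> C \<longleftrightarrow> x \<in> dual_code C" by blast
  then show ?thesis by (simp add: dual_code_def)
qed

lemma z4_cases:
  obtains "(a :: z4) = 0" | "a = 1" | "a = 2" | "a = 3"
proof -
  obtain z where z: "a = of_int z" "0 \<le> z" "z < int CARD(z4)"
    by (cases a rule: bit0_cases) auto
  then have "z = 0 \<or> z = 1 \<or> z = 2 \<or> z = 3" by auto
  with z(1) that show ?thesis by auto
qed

lemma of_nat_z4_eq_0:
  assumes "4 dvd m"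
  shows "(of_nat m :: z4) = 0"
proof -
  have "(4 :: z4) = 0" by simp
  moreover obtain j where "m = 4 * j" using assms by (rule dvdE)
  ultimately show ?thesis by (simp only: of_nat_mult of_nat_numeral mult_zero_left)
qed

lemma of_nat_z4_eq_0_iff: "(of_nat m :: z4) = 0 \<longleftrightarrow> 4 dvd m"
proof -
  have "m mod 4 < 4" by simp
  then have "m mod 4 = 0 \<or> m mod 4 = 1 \<or> m mod 4 = 2 \<or> m mod 4 = 3" by arith
  moreover have "(of_nat m :: z4) = of_nat (4 * (m div 4)) + of_nat (m mod 4)"
    by (simp only: mult_div_mod_eq flip: of_nat_add)
  moreover have "(of_nat (4 * (m div 4)) :: z4) = 0" by (rule of_nat_z4_eq_0) simp
  ultimately show ?thesis by (auto simp: dvd_eq_mod_eq_0)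
qed

lemma z4_mod2_add: "z4_mod2 (a + b) = z4_mod2 a + z4_mod2 b"
proof -
  have nat: "\<exists>m. c = of_nat m" for c :: z4
    by (cases c rule: z4_cases) (metis of_nat_0 of_nat_1 of_nat_numeral)+
  obtain l m where "a = of_nat l" "b = of_nat m" using nat by blast
  then show ?thesis by (simp only: z4_mod2_of_nat flip: of_nat_add)
qed

lemma z4_square: "a * a = (if z4_mod2 a = 0 then 0 else 1)"
  by (cases a rule: z4_cases) (simp_all add: z4_mod2_def)

lemma z4_double: "2 * a = (if z4_mod2 a = 0 then 0 else 2)"
  by (cases a rule: z4_cases) (simp_all add: z4_mod2_def)

lemma linear_residue_code:
  assumes "linear_code C"
  shows "linear_code (residue_code C)"
proof -
  have "(0 :: bit ^ 'n) = (\<chi> i. z4_mod2 ((0 :: z4 ^ 'n) $ i))"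
    by (simp add: vec_eq_iff z4_mod2_def)
  moreover have "(\<chi> i. z4_mod2 (c $ i)) + (\<chi> i. z4_mod2 (d $ i)) = (\<chi> i. z4_mod2 ((c + d) $ i))"
    for c d :: "z4 ^ 'n"
    by (simp add: vec_eq_iff z4_mod2_add)
  ultimately show ?thesis
    using assms unfolding binary_linear_code_iff linear_code_iff residue_code_def by blast
qed

text \<open>Modulo 4, odd squares are 1 and even squares are 0. Self-orthogonality of a codeword
  thus says that the number of its odd components is divisible by 4.\<close>

lemma doubly_even_residue_code:
  assumes "self_dual_code C"
  shows "doubly_even (residue_code C)"
proof -
  have "4 dvd hamming_weight (\<chi> i. z4_mod2 (c $ i))" if c: "c \<in> C" for c
  proof -
    have "std_inner c c = (\<Sum>i\<in>{i. z4_mod2 (c $ i) \<noteq> 0}. 1)"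
      unfolding std_inner_def z4_square by (rule sum.mono_neutral_cong_right) auto
    also have "\<dots> = of_nat (hamming_weight (\<chi> i. z4_mod2 (c $ i)))"
      by (simp add: hamming_weight_def)
    finally have "of_nat (hamming_weight (\<chi> i. z4_mod2 (c $ i))) = (0 :: z4)"
      using self_dual_code_mem_iff[OF assms, of c] c by simp
    then show ?thesis by (simp only: of_nat_z4_eq_0_iff)
  qed
  then show ?thesis by (auto simp: doubly_even_def residue_code_def)
qed

text \<open>The doubled word 2x lies in \<open>C\<close>: its inner product with a codeword is twice
  the overlap of \<open>x\<close> with the residue, and that overlap is even. Each component 2 has
  Lee weight 2.\<close>

lemma min_lee_weight_le_dual_residue_code:
  fixes C :: "(z4 ^ 'n) set"
  assumes C: "self_dual_code C" and x: "x \<in> dual_code (residue_code C)" "x \<noteq> 0"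
  shows "min_lee_weight C \<le> 2 * hamming_weight x"
proof -
  define y :: "z4 ^ 'n" where "y = (\<chi> i. if x $ i = 0 then 0 else 2)"
  have "std_inner y c = 0" if c: "c \<in> C" for c
  proof -
    let ?r = "\<chi> i. z4_mod2 (c $ i)"
    let ?I = "{i. x $ i \<noteq> 0 \<and> ?r $ i \<noteq> 0}"
    have "y $ i * c $ i = (if i \<in> ?I then 2 else 0)" for i
      by (simp add: y_def z4_double)
    then have "std_inner y c = of_nat (2 * card ?I)"
      by (simp add: std_inner_def sum.If_cases mult.commute)
    moreover have "std_inner x ?r = 0"
      using x(1) c by (auto simp: dual_code_def residue_code_def)
    then have "even (card ?I)" by (simp add: std_inner_bit split: if_splits)
    then have "4 dvd 2 * card ?I" by presburger
    ultimately show ?thesis by (simp only: of_nat_z4_eq_0)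
  qed
  then have "y \<in> C" using self_dual_code_mem_iff[OF C] by blast
  moreover have "y \<noteq> 0"
    using x(2) by (auto simp: y_def vec_eq_iff split: if_splits)
  ultimately have "min_lee_weight C \<le> lee_weight y"
    unfolding min_lee_weight_def by (intro Min_le) auto
  also have "lee_weight y = 2 * hamming_weight x"
    by (simp add: lee_weight_def num_comps_def hamming_weight_def y_def if_distrib[of "\<lambda>a. a = _"] cong: if_cong)
  finally show ?thesis .
qed

theorem theorem3p5:
  fixes C :: "(z4 ^ 'n) set" and k :: nat
  assumes "k > 0"
    and "CARD('n) = 24 * k + 8"
    and "self_dual_code C"
    and "min_lee_weight C = 8 * k + 8 \<or> min_lee_weight C = 8 * k + 6"
  shows "self_dual_code (residue_code C) \<and> doubly_even (residue_code C)
    \<and> extremal_self_dual (residue_code C)"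
proof -
  let ?R = "residue_code C" and ?T = "dual_code (residue_code C)"
  note n = assms(2)
  have R: "linear_code ?R" "doubly_even ?R"
    using assms(3) by (simp_all add: linear_residue_code doubly_even_residue_code self_dual_code_def)
  \<comment> \<open>Both admissible Lee weights are at least 8k + 6, and halving gives 4k +
    3.\<close>
  have T: "4 * k + 3 \<le> hamming_weight x" if "x \<in> ?T" "x \<noteq> 0" for x
    using min_lee_weight_le_dual_residue_code[OF assms(3) that] assms(4) by auto
  have "8 dvd CARD('n)" unfolding n by presburger
  then obtain D where D: "?R \<subseteq> D" "self_dual_code D" "doubly_even D"
    using doubly_even_extends_to_self_dual[OF R] by blast
  have lin: "linear_code D" and dual: "dual_code D = D"
    using D(2) by (simp_all add: self_dual_code_def)
  \<comment> \<open>Dualising reverses the inclusion, and \<open>D\<close> is its own dual.\<close>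
  have "dual_code D \<subseteq> ?T" using D(1) by (auto simp: dual_code_def)
  then have DT: "D \<subseteq> ?T" by (simp only: dual)
  have four: "4 dvd hamming_weight x" if "x \<in> D" for x
    using that D(3) by (simp add: doubly_even_def)
  have min: "4 * k + 4 \<le> hamming_weight x" if x: "x \<in> D" "x \<noteq> 0" for x
  proof -
    have "4 * k + 3 \<le> hamming_weight x" using T DT x by blast
    with four[OF x(1)] show ?thesis by presburger
  qed
  \<comment> \<open>The multiples of 4 from 4k + 4 to n - (4k + 4) = 20k + 4, which are 4k + 1
    values, together with n itself.\<close>
  define W where "W = insert (24 * k + 8) ((\<lambda>j. 4 * k + 4 + 4 * j) ` {..4 * k})"
  have "card W \<le> Suc (card {..4 * k})"
    unfolding W_def using card_image_le[of "{..4 * k}" "\<lambda>j. 4 * k + 4 + 4 * j"]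
    by (intro order_trans[OF card_insert_le_m1]) (auto simp: card_insert_if)
  then have card_W: "card W \<le> 4 * k + 2" by simp
  have W_fin: "finite W" "0 \<notin> W" by (auto simp: W_def)
  have W: "hamming_weight ` (D - {0}) \<subseteq> W"
  proof (rule image_subsetI)
    fix x assume "x \<in> D - {0}"
    then have x: "x \<in> D" "x \<noteq> 0" by simp_all
    show "hamming_weight x \<in> W"
    proof (cases "hamming_weight x = CARD('n)")
      case False
      then have "hamming_weight x \<le> 20 * k + 4"
        using doubly_even_self_dual_weight_le[OF D(2,3) min x(1)] by (simp add: n)
      moreover obtain j where "hamming_weight x = 4 * j" using four[OF x(1)] by (rule dvdE)
      ultimately have "hamming_weight x = 4 * k + 4 + 4 * (j - (k + 1))" "j - (k + 1) \<le> 4 * k"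
        using min[OF x] by simp_all
      then show ?thesis unfolding W_def by blast
    qed (simp add: W_def n)
  qed
  \<comment> \<open>The coset of \<open>v\<close> lies in \<open>?T\<close> and contains a word of
    weight at most 4k + 2, below the minimum weight of \<open>?T\<close>. That word must be 0, which
    puts \<open>v\<close> in \<open>D\<close>.\<close>
  have "v \<in> D" if v: "v \<in> ?T" for v
  proof (rule ccontr)
    assume "v \<notin> D"
    obtain x where x: "x \<in> D" "hamming_weight (x + v) \<le> card W"
      using covering_radius_le[OF D(2) W_fin W, of v] by blast
    have "x + v \<in> ?T"
      using x(1) v DT linear_dual_code[of ?R] unfolding linear_code_iff by blast
    moreover have "x + v \<noteq> 0"
    proof
      assume "x + v = 0"
      then have "x + (x + v) = x" by simp
      then have "v = x" by (simp flip: add.assoc)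
      with x(1) \<open>v \<notin> D\<close> show False by simp
    qed
    ultimately have "4 * k + 3 \<le> hamming_weight (x + v)" by (rule T)
    with x(2) card_W show False by simp
  qed
  with DT have TD: "?T = D" by blast
  \<comment> \<open>Both products equal 2^n, as the dual of either code is \<open>D\<close>.\<close>
  have "card ?R * card D = card D * card D"
    using card_mult_card_dual_code[OF R(1)] card_mult_card_dual_code[OF lin] by (simp add: TD dual)
  moreover have "card D \<noteq> 0"
    using lin by (auto simp: linear_code_iff)
  ultimately have RD: "?R = D"
    using D(1) by (intro card_subset_eq) simp_all
  obtain x where x: "x \<in> D" "x \<noteq> 0" "hamming_weight x \<le> 4 * k + 4"
    using mallows_sloane_24k_plus_8[OF n D(2,3)] by blast
  have "min_weight D = 4 * k + 4"
    unfolding min_weight_def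
  proof (rule Min_eqI)
    have "hamming_weight x = 4 * k + 4" using x min[OF x(1,2)] by simp
    then show "4 * k + 4 \<in> hamming_weight ` (D - {0})" using x(1,2) by force
  qed (use min in auto)
  moreover have "(24 * k + 8) mod 24 = 8" "(24 * k + 8) div 24 = k" by simp_all
  ultimately show ?thesis
    using D(2,3) by (simp add: RD extremal_self_dual_def n)
qed

end
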